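(* For the code-capacity toric-code decoder (clock period $q=3$) on $\mathbb Z^2$ there exists a constant $b\ge1$ such that the following holds. Suppose the syndrome configuration is trivial for all times $t\ge t_0$ and $\mathrm{supp}(\mathbf m(t_0))\subseteq B_r(\mathbf x)$ for some $r\ge1$ and $\mathbf x\in\mathbb Z^2$. Then: 1. $\mathrm{supp}(\mathbf m(t))=\varnothing$ for all $t\ge t_0+br$. 2. $\mathrm{supp}(\mathbf m(t))\subseteq B_{br}(\mathbf x)$ for all $t\ge t_0$.
   Context: Toric code (one CSS sector) on $\mathbb Z^2$: qubits live on nearest-neighbor edges; site $\mathbf r$ owns the edge joining $\mathbf r-\hat{\mathbf x}$ and $\mathbf r$ (bit $e_x(\mathbf r)$) and the edge joining $\mathbf r-\hat{\mathbf y}$ and $\mathbf r$ (bit $e_y(\mathbf r)$). The syndrome at $\mathbf r$ is the parity of errors on the four edges incident to $\mathbf r$. $B_r(\mathbf x)$ is the closed $\ell_1$ ball. $\mathrm{supp}(\mathbf m(t))$ is the set of sites at which at least one message bit is non-zero at time $t$. Decoder: site $\mathbf r$ at time $t$ carries bits $e_x,e_y,s$ (correction, correction, syndrome), message bits $m_{ij}$ for $(i,j)\in\mathcal M_2=\{(0,0),(0,1),(1,0)\}$, and a clock $c\in\{0,1,2\}$ ($q=3$); all clocks are $0$ at $t=0$. Define $\mathrm{Toom}_{ij}(\mathbf r,t)=\mathrm{Maj}\big(m_{ij}(\mathbf r,t),\,m_{ij}(\mathbf r+(-1)^{i+1}\hat{\mathbf x},t),\,m_{ij}(\mathbf r+(-1)^{j+1}\hat{\mathbf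 y},t)\big)$. Synchronous update $t\to t+1$: - $c(\mathbf r,t+1)=(c(\mathbf r,t)+1)\bmod3$. - If $s(\mathbf r,t)=1$ and $c(\mathbf r,t)=0$: if $m_{0j}(\mathbf r-\hat{\mathbf x},t)=1$ for some $j$, flip $e_x(\mathbf r)$ (defect moves to $\mathbf r-\hat{\mathbf x}$); otherwise, if $m_{i0}(\mathbf r-\hat{\mathbf y},t)=1$ for some $i$, flip $e_y(\mathbf r)$ (defect moves to $\mathbf r-\hat{\mathbf y}$). - $s(\cdot,t+1)$ is $s(\cdot,t)$ updated according to the changes of the corrections. - $m_{ij}(\mathbf r,t+1)=1$ iff at least one of: (i) $s(\mathbf r,t)=1$; (ii) some defect moves into $\mathbf r$ during this step; (iii) $s(\mathbf r,t)=0$, $m_{ij}(\mathbf r,t)=0$, $c(\mathbf r,t)\in\{0,1\}$, and $m_{ij}(\mathbf r+(-1)^{i+1}\hat{\mathbf x},t)=1$ or $m_{ij}(\mathbf r+(-1)^{j+1}\hat{\mathbf y},t)=1$; (iv) $s(\mathbf r,t)=0$, $m_{ij}(\mathbf r,t)=1$, and $\mathrm{Toom}_{ij}(\mathbf r,t)=1$; (v) $s(\mathbf r,t)=0$, $m_{ij}(\mathbf r,t)=1$, $(i,j)\ne(0,0)$, $m_{00}(\mathbf r,t)=1$, and $\mathrm{Toom}_{00}(\mathbf r,t)=1$. Otherwise it is $0$. *)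

theory Defs
  imports Complex_Main "HOL-Library.Product_Plus"
begin

type_synonym site = "int \<times> int"

text \<open>Message flavours are the pairs in \<open>M2\<close>. The components \<open>msg i j\<close> with \<open>(i, j) \<notin> M2\<close> carry
  no meaning: neither the defect moves, nor the components in \<open>M2\<close>, nor \<open>msg_supp\<close> depend on them.\<close>

record cell =
  corr_x :: bool
  corr_y :: bool
  synd :: bool
  msg :: "nat \<Rightarrow> nat \<Rightarrow> bool"
  clock :: nat

type_synonym config = "site \<Rightarrow> cell"

definition M2 :: "(nat \<times> nat) set" where
  "M2 = {(0, 0), (0, 1), (1, 0)}"

text \<open>A set of edges is a pair of functions \<open>ax\<close>, \<open>ay\<close>, where \<open>ax r\<close> refers to the edge joining
  \<open>r - (1, 0)\<close> and \<open>r\<close>, and \<open>ay r\<close> to the edge joining \<open>r - (0, 1)\<close> and \<open>r\<close>.\<close>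

definition edge_parity :: "(site \<Rightarrow> bool) \<Rightarrow> (site \<Rightarrow> bool) \<Rightarrow> site \<Rightarrow> bool" where
  "edge_parity ax ay r \<longleftrightarrow>
     odd (of_bool (ax r) + of_bool (ax (r + (1, 0))) +
          of_bool (ay r) + of_bool (ay (r + (0, 1))) :: nat)"

definition maj :: "bool \<Rightarrow> bool \<Rightarrow> bool \<Rightarrow> bool" where
  "maj a b c \<longleftrightarrow> (a \<and> b) \<or> (a \<and> c) \<or> (b \<and> c)"

definition nbr_x :: "nat \<Rightarrow> site \<Rightarrow> site" where
  "nbr_x i r = r + ((-1) ^ (i + 1), 0)"

definition nbr_y :: "nat \<Rightarrow> site \<Rightarrow> site" where
  "nbr_y j r = r + (0, (-1) ^ (j + 1))"

definition toom :: "config \<Rightarrow> nat \<Rightarrow> nat \<Rightarrow> site \<Rightarrow> bool" where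
  "toom \<sigma> i j r \<longleftrightarrow>
     maj (msg (\<sigma> r) i j) (msg (\<sigma> (nbr_x i r)) i j) (msg (\<sigma> (nbr_y j r)) i j)"

definition moves_x :: "config \<Rightarrow> site \<Rightarrow> bool" where
  "moves_x \<sigma> r \<longleftrightarrow> synd (\<sigma> r) \<and> clock (\<sigma> r) = 0 \<and>
     (\<exists>j. (0, j) \<in> M2 \<and> msg (\<sigma> (r - (1, 0))) 0 j)"

definition moves_y :: "config \<Rightarrow> site \<Rightarrow> bool" where
  "moves_y \<sigma> r \<longleftrightarrow> synd (\<sigma> r) \<and> clock (\<sigma> r) = 0 \<and> \<not> moves_x \<sigma> r \<and>
     (\<exists>i. (i, 0) \<in> M2 \<and> msg (\<sigma> (r - (0, 1))) i 0)"

definition moves_into :: "config \<Rightarrow> site \<Rightarrow> bool" where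
  "moves_into \<sigma> r \<longleftrightarrow> moves_x \<sigma> (r + (1, 0)) \<or> moves_y \<sigma> (r + (0, 1))"

definition next_msg :: "config \<Rightarrow> site \<Rightarrow> nat \<Rightarrow> nat \<Rightarrow> bool" where
  "next_msg \<sigma> r i j \<longleftrightarrow>
     synd (\<sigma> r) \<or>
     moves_into \<sigma> r \<or>
     (\<not> synd (\<sigma> r) \<and> \<not> msg (\<sigma> r) i j \<and> clock (\<sigma> r) \<in> {0, 1} \<and>
        (msg (\<sigma> (nbr_x i r)) i j \<or> msg (\<sigma> (nbr_y j r)) i j)) \<or>
     (\<not> synd (\<sigma> r) \<and> msg (\<sigma> r) i j \<and> toom \<sigma> i j r) \<or>
     (\<not> synd (\<sigma> r) \<and> msg (\<sigma> r) i j \<and> (i, j) \<noteq> (0, 0) \<and> msg (\<sigma> r) 0 0 \<and> toom \<sigma> 0 0 r)"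

definition step :: "config \<Rightarrow> config" where
  "step \<sigma> = (\<lambda>r.
     \<lparr> corr_x = (corr_x (\<sigma> r) \<noteq> moves_x \<sigma> r),
       corr_y = (corr_y (\<sigma> r) \<noteq> moves_y \<sigma> r),
       synd = (synd (\<sigma> r) \<noteq> edge_parity (moves_x \<sigma>) (moves_y \<sigma>) r),
       msg = next_msg \<sigma> r,
       clock = (clock (\<sigma> r) + 1) mod 3 \<rparr>)"

text \<open>Code capacity: a fixed error pattern \<open>(err_x, err_y)\<close>, possibly infinite, is present from
  time \<open>0\<close>, and no further noise acts. The initial syndrome is that of the error combined with the
  initial corrections; initial corrections and messages are arbitrary.\<close>

definition code_capacity_run ::
    "(site \<Rightarrow> bool) \<Rightarrow> (site \<Rightarrow> bool) \<Rightarrow> (nat \<Rightarrow> config) \<Rightarrow> bool" where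
  "code_capacity_run err_x err_y \<sigma> \<longleftrightarrow>
     (\<forall>r. clock (\<sigma> 0 r) = 0) \<and>
     (\<forall>r. synd (\<sigma> 0 r) = edge_parity (\<lambda>r'. err_x r' \<noteq> corr_x (\<sigma> 0 r'))
                                     (\<lambda>r'. err_y r' \<noteq> corr_y (\<sigma> 0 r')) r) \<and>
     (\<forall>t. \<sigma> (Suc t) = step (\<sigma> t))"

definition msg_supp :: "config \<Rightarrow> site set" where
  "msg_supp \<sigma> = {r. \<exists>(i, j) \<in> M2. msg (\<sigma> r) i j}"

definition l1_ball :: "site \<Rightarrow> real \<Rightarrow> site set" where
  "l1_ball x \<rho> = {y. real_of_int (\<bar>fst y - fst x\<bar> + \<bar>snd y - snd x\<bar>) \<le> \<rho>}"

end

theory Submission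
  imports Defs
begin

text \<open>Without defects, a message of flavour \<open>(i, j)\<close> is governed by the functional \<open>height i j\<close>,
  which decreases by one towards either of the two neighbours it listens to. Every surviving or newly
  created message has such a neighbour one level below, so the lowest occupied level rises in every
  step. The highest level rises only when the clock is not 2, hence the occupied strip loses one level
  per clock period and vanishes after a time linear in its width. Rule (v) slows this down only for
  flavours other than \<open>(0, 0)\<close>, so one waits for flavour \<open>(0, 0)\<close> to die out and then repeats the
  argument; messages travel at most one site per step, so the second width is still linear in \<open>r\<close>.\<close>

definition height :: "nat \<Rightarrow> nat \<Rightarrow> site \<Rightarrow> int" where
  "height i j y = (-1) ^ i * fst y + (-1) ^ j * snd y"

lemma height_nbr_x: "height i j (nbr_x i y) = height i j y - 1"
  by (cases "even i") (simp_all add: height_def nbr_x_def)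

lemma height_nbr_y: "height i j (nbr_y j y) = height i j y - 1"
  by (cases "even j") (simp_all add: height_def nbr_y_def)

lemma abs_sign_mult: "\<bar>(-1) ^ k * a\<bar> = \<bar>a\<bar>" for a :: int
  by (simp add: abs_mult power_abs)

text \<open>Used to enclose a ball of radius \<rho> in a strip of heights of width 2 \<rho>, which
  is where the ball enters the count of levels.\<close>

lemma height_diff_le_l1:
  "\<bar>height i j y - height i j x\<bar> \<le> \<bar>fst y - fst x\<bar> + \<bar>snd y - snd x\<bar>"
proof -
  have "height i j y - height i j x = (-1) ^ i * (fst y - fst x) + (-1) ^ j * (snd y - snd x)"
    by (simp add: height_def algebra_simps)
  then show ?thesis
    using abs_triangle_ineq[of "(-1) ^ i * (fst y - fst x)" "(-1) ^ j * (snd y - snd x)"]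
    by (simp add: abs_sign_mult)
qed

lemma l1_ball_mono: "\<rho> \<le> \<rho>' \<Longrightarrow> l1_ball x \<rho> \<subseteq> l1_ball x \<rho>'"
  by (auto simp: l1_ball_def)

lemma mem_l1_ball_nbr_x: "nbr_x i y \<in> l1_ball x \<rho> \<Longrightarrow> y \<in> l1_ball x (\<rho> + 1)"
  by (cases "even i") (auto simp: l1_ball_def nbr_x_def)

lemma mem_l1_ball_nbr_y: "nbr_y j y \<in> l1_ball x \<rho> \<Longrightarrow> y \<in> l1_ball x (\<rho> + 1)"
  by (cases "even j") (auto simp: l1_ball_def nbr_y_def)

lemma code_capacity_run_clock:
  assumes "code_capacity_run err_x err_y \<sigma>"
  shows "clock (\<sigma> t y) = t mod 3"
  using assms by (induction t arbitrary: y) (auto simp: code_capacity_run_def step_def mod_Suc_eq)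

locale defect_free_run =
  fixes \<sigma> :: "nat \<Rightarrow> config" and t0 :: nat
  assumes run: "\<sigma> (Suc t) = step (\<sigma> t)"
    and clock: "clock (\<sigma> t y) = t mod 3"
    and defect_free: "t0 \<le> t \<Longrightarrow> \<not> synd (\<sigma> t y)"
begin

lemma msg_Suc:
  assumes "t0 \<le> t"
  shows "msg (\<sigma> (Suc t) y) i j \<longleftrightarrow>
    (if msg (\<sigma> t y) i j
     then toom (\<sigma> t) i j y \<or> ((i, j) \<noteq> (0, 0) \<and> msg (\<sigma> t y) 0 0 \<and> toom (\<sigma> t) 0 0 y)
     else t mod 3 \<noteq> 2 \<and> (msg (\<sigma> t (nbr_x i y)) i j \<or> msg (\<sigma> t (nbr_y j y)) i j))"
proof -
  have "t mod 3 \<in> {0, 1} \<longleftrightarrow> t mod 3 \<noteq> 2"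
    by auto
  then show ?thesis
    using defect_free[OF assms]
    by (simp add: run step_def next_msg_def moves_into_def moves_x_def moves_y_def clock)
qed

text \<open>The second assumption silences rule (v). Next to a present message, a Toom majority just
  asks for one more vote, so survival and creation both need an occupied neighbour and differ only
  at clock 2, where nothing is created.\<close>

lemma msg_Suc_pure:
  assumes "t0 \<le> t" and "(i, j) = (0, 0) \<or> (\<forall>y. \<not> msg (\<sigma> t y) 0 0)"
  shows "msg (\<sigma> (Suc t) y) i j \<longleftrightarrow>
    (msg (\<sigma> t (nbr_x i y)) i j \<or> msg (\<sigma> t (nbr_y j y)) i j) \<and> (t mod 3 = 2 \<longrightarrow> msg (\<sigma> t y) i j)"
proof -
  have "\<not> ((i, j) \<noteq> (0, 0) \<and> msg (\<sigma> t y) 0 0 \<and> toom (\<sigma> t) 0 0 y)"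
    using assms(2) by blast
  then show ?thesis
    unfolding msg_Suc[OF assms(1)] toom_def maj_def by argo
qed

lemma msg_supp_Suc:
  assumes "t0 \<le> t" and "msg_supp (\<sigma> t) \<subseteq> l1_ball x \<rho>"
  shows "msg_supp (\<sigma> (Suc t)) \<subseteq> l1_ball x (\<rho> + 1)"
proof
  fix y assume "y \<in> msg_supp (\<sigma> (Suc t))"
  then obtain i j where ij: "(i, j) \<in> M2" and m: "msg (\<sigma> (Suc t) y) i j"
    by (auto simp: msg_supp_def)
  have supp: "z \<in> l1_ball x \<rho>" if "msg (\<sigma> t z) i j" for z
    using that ij assms(2) by (auto simp: msg_supp_def)
  have "msg (\<sigma> t y) i j \<or> msg (\<sigma> t (nbr_x i y)) i j \<or> msg (\<sigma> t (nbr_y j y)) i j"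
    using m by (auto simp: msg_Suc[OF assms(1)] split: if_splits)
  then show "y \<in> l1_ball x (\<rho> + 1)"
  proof (elim disjE)
    assume "msg (\<sigma> t y) i j"
    then show ?thesis
      using subsetD[OF l1_ball_mono supp, of "\<rho> + 1"] by simp
  next
    assume "msg (\<sigma> t (nbr_x i y)) i j"
    then show ?thesis
      by (intro mem_l1_ball_nbr_x supp)
  next
    assume "msg (\<sigma> t (nbr_y j y)) i j"
    then show ?thesis
      by (intro mem_l1_ball_nbr_y supp)
  qed
qed

text \<open>This holds with rule (v) active, so it controls the other flavours while (0, 0) is still
  dying.\<close>

lemma msg_supp_light_cone:
  assumes "msg_supp (\<sigma> t0) \<subseteq> l1_ball x \<rho>"
  shows "msg_supp (\<sigma> (t0 + n)) \<subseteq> l1_ball x (\<rho> + real n)"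
proof (induction n)
  case 0
  then show ?case using assms by simp
next
  case (Suc n)
  from msg_supp_Suc[OF _ Suc] show ?case
    by (simp add: algebra_simps)
qed

text \<open>The difference of the two quotients by 3 counts the steps at clock 2 between
  \<open>t1\<close> and \<open>t\<close>, whatever the phase of \<open>t1\<close>; each such step
  costs the strip one level.\<close>

lemma height_bounds:
  assumes pure: "(i, j) = (0, 0) \<or> (\<forall>t\<ge>t1. \<forall>y. \<not> msg (\<sigma> t y) 0 0)"
    and t1: "t0 \<le> t1"
    and init: "\<And>y. msg (\<sigma> t1 y) i j \<Longrightarrow> L \<le> height i j y \<and> height i j y \<le> U"
    and "t1 \<le> t" and "msg (\<sigma> t y) i j"
  shows "L + int (t - t1) \<le> height i j y \<and>
    height i j y \<le> U + int (t - t1) - (int (t div 3) - int (t1 div 3))"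
  using \<open>t1 \<le> t\<close> \<open>msg (\<sigma> t y) i j\<close>
proof (induction t arbitrary: y rule: dec_induct)
  case base
  then show ?case using init by simp
next
  case (step t)
  from step.hyps t1 pure step.prems
  have nbr: "msg (\<sigma> t (nbr_x i y)) i j \<or> msg (\<sigma> t (nbr_y j y)) i j"
    and old: "t mod 3 = 2 \<Longrightarrow> msg (\<sigma> t y) i j"
    by (auto simp: msg_Suc_pure)
  have shifted: "L + int (t - t1) \<le> height i j y - 1 \<and>
      height i j y - 1 \<le> U + int (t - t1) - (int (t div 3) - int (t1 div 3))"
    using nbr step.IH height_nbr_x height_nbr_y by metis
  show ?case
  proof (cases "t mod 3 = 2")
    \<comment> \<open>Here \<open>y\<close> itself was occupied at time \<open>t\<close>, so its
      height obeys the old upper bound: the growth of \<open>t - t1\<close> and of the quotient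
      cancel.\<close>
    case True
    then have "Suc t div 3 = Suc (t div 3)"
      by presburger
    then show ?thesis
      using shifted step.IH[OF old[OF True]] step.hyps by (simp add: Suc_diff_le)
  next
    case False
    then have "Suc t div 3 = t div 3"
      by presburger
    then show ?thesis
      using shifted step.hyps by (simp add: Suc_diff_le)
  qed
qed

lemma flavour_dies:
  assumes pure: "(i, j) = (0, 0) \<or> (\<forall>t\<ge>t1. \<forall>y. \<not> msg (\<sigma> t y) 0 0)"
    and t1: "t0 \<le> t1" and ij: "(i, j) \<in> M2"
    and supp: "msg_supp (\<sigma> t1) \<subseteq> l1_ball x \<rho>"
    and t: "real t1 + 6 * \<rho> + 3 \<le> real t" and \<rho>: "0 \<le> \<rho>"
  shows "\<not> msg (\<sigma> t y) i j"
proof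
  assume m: "msg (\<sigma> t y) i j"
  \<comment> \<open>Heights are integers, so rounding the radius down loses nothing.\<close>
  define R where "R = \<lfloor>\<rho>\<rfloor>"
  have "height i j x - R \<le> height i j z \<and> height i j z \<le> height i j x + R"
    if "msg (\<sigma> t1 z) i j" for z
  proof -
    have "z \<in> l1_ball x \<rho>"
      using that ij supp by (auto simp: msg_supp_def)
    then have "\<bar>fst z - fst x\<bar> + \<bar>snd z - snd x\<bar> \<le> R"
      unfolding R_def l1_ball_def by (simp add: le_floor_iff)
    then show ?thesis
      using height_diff_le_l1[of i j z x] by linarith
  qed
  moreover have "t1 \<le> t"
    using t \<rho> by linarith
  ultimately have "int (t div 3) - int (t1 div 3) \<le> 2 * R"
    using height_bounds[OF pure t1 _ _ m, of "height i j x - R" "height i j x + R"] by fastforce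
  \<comment> \<open>That is 2 R + 1 full clock periods, one more step at clock 2 than the strip of
    width 2 R can survive.\<close>
  moreover have "int t1 + 6 * R + 3 \<le> int t"
    using t unfolding R_def by linarith
  ultimately show False
    by linarith
qed

lemma supp_dies:
  assumes r: "1 \<le> r" and supp: "msg_supp (\<sigma> t0) \<subseteq> l1_ball x r"
    and t: "real t0 + 80 * r \<le> real t"
  shows "msg_supp (\<sigma> t) = {}"
proof -
  \<comment> \<open>Long enough for flavour (0, 0), since 6 r + 3 \<le> 9 r for r \<ge> 1.\<close>
  define t1 where "t1 = t0 + nat \<lceil>9 * r\<rceil>"
  have t1: "real t0 + 9 * r \<le> real t1" "real t1 \<le> real t0 + 9 * r + 1" "t0 \<le> t1"
    using r unfolding t1_def by linarith+
  have dead00: "\<not> msg (\<sigma> u y) 0 0" if "t1 \<le> u" for u y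
    by (rule flavour_dies[OF _ _ _ supp]) (use that t1 r in \<open>auto simp: M2_def\<close>)
  have supp1: "msg_supp (\<sigma> t1) \<subseteq> l1_ball x (10 * r + 1)"
    using msg_supp_light_cone[OF supp, of "t1 - t0"] t1 l1_ball_mono[of "r + real (t1 - t0)" "10 * r + 1" x]
    by simp
  \<comment> \<open>The total delay is at most (9 r + 1) + 6 (10 r + 1) + 3 = 69 r + 10 \<le> 80
    r.\<close>
  have "\<not> msg (\<sigma> t y) i j" if "(i, j) \<in> M2" for i j y
    by (rule flavour_dies[OF _ t1(3) that supp1]) (use dead00 t1 t r in auto)
  then show ?thesis
    by (auto simp: msg_supp_def)
qed

lemma supp_bounded:
  assumes r: "1 \<le> r" and supp: "msg_supp (\<sigma> t0) \<subseteq> l1_ball x r" and "t0 \<le> t"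
  shows "msg_supp (\<sigma> t) \<subseteq> l1_ball x (81 * r)"
proof (cases "real t0 + 80 * r \<le> real t")
  case True
  then show ?thesis
    using supp_dies[OF r supp] by simp
next
  case False
  \<comment> \<open>Before extinction the light cone has had less than 80 r steps to widen the
    initial radius r.\<close>
  then have "r + real (t - t0) \<le> 81 * r"
    using \<open>t0 \<le> t\<close> by simp
  then show ?thesis
    using msg_supp_light_cone[OF supp, of "t - t0"] \<open>t0 \<le> t\<close>
      l1_ball_mono[of "r + real (t - t0)" "81 * r" x] by simp
qed

end

theorem lemma5p9:
  "\<exists>b::real. b \<ge> 1 \<and>
     (\<forall>(err_x :: site \<Rightarrow> bool) (err_y :: site \<Rightarrow> bool) (\<sigma> :: nat \<Rightarrow> config)
        (t0 :: nat) (r :: real) (x :: site).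
        code_capacity_run err_x err_y \<sigma> \<and>
        (\<forall>t\<ge>t0. \<forall>y. \<not> synd (\<sigma> t y)) \<and>
        r \<ge> 1 \<and> msg_supp (\<sigma> t0) \<subseteq> l1_ball x r
        \<longrightarrow>
        (\<forall>t::nat. real t \<ge> real t0 + b * r \<longrightarrow> msg_supp (\<sigma> t) = {}) \<and>
        (\<forall>t\<ge>t0. msg_supp (\<sigma> t) \<subseteq> l1_ball x (b * r)))"
proof -
  have "(\<forall>t. real t0 + 81 * r \<le> real t \<longrightarrow> msg_supp (\<sigma> t) = {}) \<and>
      (\<forall>t\<ge>t0. msg_supp (\<sigma> t) \<subseteq> l1_ball x (81 * r))"
    if ccr: "code_capacity_run err_x err_y \<sigma>" and quiet: "\<forall>t\<ge>t0. \<forall>y. \<not> synd (\<sigma> t y)"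
      and r: "1 \<le> r" and supp: "msg_supp (\<sigma> t0) \<subseteq> l1_ball x r"
    for err_x err_y \<sigma> t0 r x
  proof -
    interpret defect_free_run \<sigma> t0
    proof
      show "\<sigma> (Suc t) = step (\<sigma> t)" for t
        using ccr by (simp add: code_capacity_run_def)
      show "clock (\<sigma> t y) = t mod 3" for t y
        using ccr by (rule code_capacity_run_clock)
      show "\<not> synd (\<sigma> t y)" if "t0 \<le> t" for t y
        using quiet that by blast
    qed
    show ?thesis
      using supp_dies[OF r supp] supp_bounded[OF r supp] r by simp
  qed
  then show ?thesis
    by (intro exI[of _ 81] conjI, simp, blast)
qed

end
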